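(* Let $\nu_-,\rho_-,c_-,b,\Delta t,\Delta z_->0$ and set $$d_-=\frac{\nu_-\,\Delta t}{\rho_- c_-(\Delta z_-)^2},\qquad \beta_-=\frac{b\,\Delta t}{\rho_- c_-\,\Delta z_-}.$$ Consider the diffusion equation $\partial_t T_-=\partial_z(K_-\partial_z T_-)$ on $z<0$, with $K_-=\nu_-/(\rho_-c_-)$, discretized by backward Euler in the interior with explicit treatment of the interfacial bulk flux, i.e. the scheme, for $n\ge 0$, $$T_{j+\frac12}^{n+1}-T_{j+\frac12}^{n}=d_-\left(T_{j+\frac32}^{n+1}-2T_{j+\frac12}^{n+1}+T_{j-\frac12}^{n+1}\right),\quad j<-1,$$ $$T_{-\frac12}^{n+1}-T_{-\frac12}^{n}=-\beta_-T_{-\frac12}^{n}-d_-\left(T_{-\frac12}^{n+1}-T_{-\frac32}^{n+1}\right).$$ Then this scheme is stable (in the normal-mode sense: every normal-mode solution satisfying the far-field condition has amplification factor of modulus at most $1$) if and only if $$\beta_-\le 1+\sqrt{1+2d_-}.$$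
   Context: This is a one-way coupled (forced) model of heat diffusion in the half-line $z<0$ (ocean). The grid is uniform with cell centers $z_{j+1/2}=(j+\tfrac12)\Delta z_-$, $j=-1,-2,\dots$, and $T^n_{j+1/2}$ denotes the approximation at $z_{j+1/2}$ and time $n\Delta t$. At the interface $z=0$ a bulk flux $q_0^{n+1}=b\,(T_{1/2}^n-T_{-1/2}^n)$ with bulk coefficient $b$ is imposed, where the external value is fixed to $T_{1/2}^n=0$. Normal modes and stability: a normal-mode solution is a solution of the scheme of the form $T_{j+\frac12}^{n}=\mathcal{A}^{n}\kappa_-^{\,j}$ for all integers $j\le -1$, $n\ge 0$, with $\mathcal{A},\kappa_-\in\mathbb{C}\setminus\{0\}$. It satisfies the far-field condition ($\kappa_-^{\,j}\to0$ as $j\to-\infty$) when $|\kappa_-|>1$. The scheme is called stable when every normal-mode solution with $|\kappa_-|>1$ satisfies $|\mathcal{A}|\le 1$. *)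

theory Defs
  imports Complex_Main
begin

text \<open>
  A grid function \<open>T\<close> is indexed so that \<open>T n j\<close>, for \<open>j \<le> -1\<close>, is the value at time level \<open>n\<close>
  in the cell with centre \<open>(j + 1/2) \<Delta>z\<close>. Values at \<open>j \<ge> 0\<close> are never referred to: the external
  value above the interface is fixed to \<open>0\<close>, so the bulk flux at the interface is
  \<open>b * (0 - T n (-1))\<close>, which gives the term \<open>-\<beta> * T n (-1)\<close> below. Grid functions are
  complex-valued because normal modes are.
\<close>

definition heat_scheme_solution ::
  "real \<Rightarrow> real \<Rightarrow> (nat \<Rightarrow> int \<Rightarrow> complex) \<Rightarrow> bool" where
  "heat_scheme_solution d \<beta> T \<longleftrightarrow>
     (\<forall>n. \<forall>j < - 1. T (Suc n) j - T n j =
        of_real d * (T (Suc n) (j + 1) - 2 * T (Suc n) j + T (Suc n) (j - 1))) \<and>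
     (\<forall>n. T (Suc n) (-1) - T n (-1) =
        - of_real \<beta> * T n (-1) - of_real d * (T (Suc n) (-1) - T (Suc n) (-2)))"

definition has_normal_mode_form ::
  "(nat \<Rightarrow> int \<Rightarrow> complex) \<Rightarrow> complex \<Rightarrow> complex \<Rightarrow> bool" where
  "has_normal_mode_form T A \<kappa> \<longleftrightarrow>
     A \<noteq> 0 \<and> \<kappa> \<noteq> 0 \<and> (\<forall>n. \<forall>j \<le> - 1. T n j = A ^ n * \<kappa> powi j)"

text \<open>
  The hypothesis \<open>cmod \<kappa> > 1\<close> is the far-field condition: \<open>\<kappa> powi j\<close> tends to \<open>0\<close> as \<open>j\<close> tends
  to \<open>-\<infinity>\<close>.
\<close>

definition normal_mode_stable :: "((nat \<Rightarrow> int \<Rightarrow> complex) \<Rightarrow> bool) \<Rightarrow> bool" where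
  "normal_mode_stable scheme \<longleftrightarrow>
     (\<forall>T A \<kappa>. scheme T \<and> has_normal_mode_form T A \<kappa> \<and> cmod \<kappa> > 1 \<longrightarrow> cmod A \<le> 1)"

end

theory Submission
  imports Defs
begin

text \<open>
  Put \<open>u = 1 - 1/\<kappa>\<close>. A normal mode solves the scheme iff \<open>A = 1 - \<beta> u\<close> and \<open>u\<close> is a root of the
  real quadratic \<open>d \<beta> u\<^sup>2 + (\<beta> - d) u - \<beta>\<close>, whose discriminant is nonnegative, so \<open>u\<close> and \<open>A\<close> are real.
  The far-field condition \<open>\<bar>1 - u\<bar> < 1\<close> forces \<open>u > 0\<close>, hence instability means \<open>x > 2\<close> for
  \<open>x = \<beta> u\<close>. Since \<open>d x (x - 1) + \<beta> x = \<beta>\<^sup>2\<close>, this yields \<open>\<beta>\<^sup>2 > 2 d + 2 \<beta>\<close>, i.e.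
  \<open>\<beta> > 1 + sqrt (1 + 2 d)\<close>. Conversely, under that inequality the quadratic changes sign between
  \<open>2/\<beta>\<close> and \<open>1\<close>, which gives an unstable mode.
\<close>

text \<open>Every equation of the scheme carries a common factor
  \<open>A ^ n * \<kappa> powi j\<close>, nonzero because \<open>A\<close> and
  \<open>\<kappa>\<close> are. Cancelling it leaves one interior and one boundary equation, both
  free of \<open>n\<close> and \<open>j\<close>.\<close>

lemma normal_mode_solution_iff:
  assumes "has_normal_mode_form T A \<kappa>"
  shows "heat_scheme_solution d \<beta> T \<longleftrightarrow>
    A - 1 = of_real d * A * (\<kappa> - 2 + inverse \<kappa>) \<and>
    A - 1 = - of_real \<beta> - of_real d * A * (1 - inverse \<kappa>)"
    (is "_ \<longleftrightarrow> ?I \<and> ?B")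
proof -
  have A: "A \<noteq> 0" and \<kappa>: "\<kappa> \<noteq> 0" and T: "\<And>n j. j \<le> -1 \<Longrightarrow> T n j = A ^ n * \<kappa> powi j"
    using assms by (auto simp: has_normal_mode_form_def)
  have interior: "T (Suc n) j - T n j =
        of_real d * (T (Suc n) (j + 1) - 2 * T (Suc n) j + T (Suc n) (j - 1)) \<longleftrightarrow> ?I"
    if "j < -1" for n j
  proof -
    have "T (Suc n) j - T n j = A ^ n * \<kappa> powi j * (A - 1)"
      using that by (simp add: T algebra_simps)
    moreover have "of_real d * (T (Suc n) (j + 1) - 2 * T (Suc n) j + T (Suc n) (j - 1))
        = A ^ n * \<kappa> powi j * (of_real d * A * (\<kappa> - 2 + inverse \<kappa>))"
      using that \<kappa> by (simp add: T power_int_add power_int_diff field_simps)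
    ultimately show ?thesis
      using A \<kappa> by (simp only: mult_cancel_left power_not_zero power_int_eq_0_iff) simp
  qed
  have boundary: "T (Suc n) (-1) - T n (-1) =
        - of_real \<beta> * T n (-1) - of_real d * (T (Suc n) (-1) - T (Suc n) (-2)) \<longleftrightarrow> ?B" for n
  proof -
    have p: "\<kappa> powi (-2) = inverse \<kappa> * inverse \<kappa>" "\<kappa> powi (-1) = inverse \<kappa>"
      by (simp_all add: power_int_def power2_eq_square)
    have "T (Suc n) (-1) - T n (-1) = A ^ n * inverse \<kappa> * (A - 1)"
      by (simp add: T p algebra_simps)
    moreover have "- of_real \<beta> * T n (-1) - of_real d * (T (Suc n) (-1) - T (Suc n) (-2))
        = A ^ n * inverse \<kappa> * (- of_real \<beta> - of_real d * A * (1 - inverse \<kappa>))"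
      by (simp add: T p algebra_simps)
    ultimately show ?thesis
      using A \<kappa> by simp
  qed
  have "(\<forall>n::nat. \<forall>j::int. j < -1 \<longrightarrow> ?I) \<longleftrightarrow> ?I"
    by (meson lt_ex)
  with interior boundary show ?thesis
    unfolding heat_scheme_solution_def by simp
qed

text \<open>Since \<open>\<kappa> - 2 + inverse \<kappa> = \<kappa> * u\<^sup>2\<close>, adding
  \<open>1 - u\<close> times the interior equation to \<open>u\<close> times the boundary equation
  eliminates the diffusion terms and leaves \<open>A - 1 = - \<beta> * u\<close>. Substituting this
  into the boundary equation gives the quadratic.\<close>

lemma dispersion_relation_iff:
  fixes A \<kappa> d \<beta> :: "'a::field"
  assumes "\<kappa> \<noteq> 0" and "u = 1 - inverse \<kappa>"
  shows "A - 1 = d * A * (\<kappa> - 2 + inverse \<kappa>) \<and> A - 1 = - \<beta> - d * A * (1 - inverse \<kappa>) \<longleftrightarrow>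
    A = 1 - \<beta> * u \<and> d * \<beta> * u\<^sup>2 + (\<beta> - d) * u = \<beta>" (is "?I \<and> ?B \<longleftrightarrow> ?A \<and> ?Q")
proof -
  have ku: "\<kappa> * (1 - u) = 1" and inv: "inverse \<kappa> = 1 - u"
    using assms by simp_all
  have I: "?I \<longleftrightarrow> A - 1 = d * A * (\<kappa> - 1 - u)" and B: "?B \<longleftrightarrow> A - 1 = - \<beta> - d * A * u"
    unfolding inv by (simp_all add: algebra_simps)
  show ?thesis
    unfolding I B
  proof (intro iffI conjI; elim conjE)
    assume 1: "A - 1 = d * A * (\<kappa> - 1 - u)" and 2: "A - 1 = - \<beta> - d * A * u"
    show 3: "A = 1 - \<beta> * u"
      using ku 1 2 by algebra
    show "d * \<beta> * u\<^sup>2 + (\<beta> - d) * u = \<beta>"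
      using ku 2 3 by algebra
  next
    assume 1: "A = 1 - \<beta> * u" and 2: "d * \<beta> * u\<^sup>2 + (\<beta> - d) * u = \<beta>"
    show "A - 1 = d * A * (\<kappa> - 1 - u)"
      using ku 1 2 by algebra
    show "A - 1 = - \<beta> - d * A * u"
      using 1 2 by algebra
  qed
qed

text \<open>Completing the square: \<open>2 * a * z + b\<close> squares to the discriminant, which
  is the square of a real \<open>s\<close>, so it equals \<open>s\<close> or
  \<open>- s\<close>.\<close>

lemma complex_root_of_real_quadratic:
  fixes a b c :: real and z :: complex
  assumes "a \<noteq> 0" and "b\<^sup>2 - 4 * a * c \<ge> 0"
    and "of_real a * z\<^sup>2 + of_real b * z + of_real c = 0"
  shows "z \<in> \<real>"
proof -
  define s where "s = sqrt (b\<^sup>2 - 4 * a * c)"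
  have "(complex_of_real s)\<^sup>2 = of_real (b\<^sup>2 - 4 * a * c)"
    using assms(2) by (simp add: s_def flip: of_real_power)
  then have "(2 * of_real a * z + of_real b)\<^sup>2 = (complex_of_real s)\<^sup>2"
    using assms(3) unfolding of_real_diff of_real_mult of_real_power of_real_numeral by algebra
  then have "2 * of_real a * z + of_real b = complex_of_real s \<or>
      2 * of_real a * z + of_real b = complex_of_real (- s)"
    by (simp add: power2_eq_iff)
  then obtain t :: real where "2 * of_real a * z + of_real b = complex_of_real t"
    by blast
  then have "z = of_real ((t - b) / (2 * a))"
    using assms(1) by (simp add: field_simps eq_diff_eq)
  then show ?thesis
    by simp
qed

lemma amplification_bounded:
  fixes d \<beta> :: real
  assumes "d > 0" and "\<beta> > 0" and stab: "\<beta>\<^sup>2 \<le> 2 * d + 2 * \<beta>"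
    and quad: "of_real d * of_real \<beta> * u\<^sup>2 + (of_real \<beta> - of_real d) * u = complex_of_real \<beta>"
    and far: "cmod (1 - u) < 1"
  shows "cmod (1 - of_real \<beta> * u) \<le> 1"
proof -
  have "u \<in> \<real>"
  proof (rule complex_root_of_real_quadratic)
    \<comment> \<open>The discriminant is
      \<open>(\<beta> - d)\<^sup>2 + 4 * d * \<beta>\<^sup>2\<close>.\<close>
    show "d * \<beta> \<noteq> 0" "(\<beta> - d)\<^sup>2 - 4 * (d * \<beta>) * (- \<beta>) \<ge> 0"
      using assms by auto
  qed (use quad in simp)
  then obtain r where u: "u = of_real r"
    by (rule Reals_cases)
  have "of_real (d * \<beta> * r\<^sup>2 + (\<beta> - d) * r) = complex_of_real \<beta>"
    using quad by (simp add: u)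
  then have root: "d * \<beta> * r\<^sup>2 + (\<beta> - d) * r = \<beta>"
    unfolding of_real_eq_iff .
  have "\<bar>1 - r\<bar> < 1"
    using far by (simp add: u flip: norm_of_real[where 'a = complex])
  then have r: "r > 0"
    by simp
  \<comment> \<open>As \<open>\<beta> * r > 0\<close>, the real factor
    \<open>1 - \<beta> * r\<close> is below \<open>1\<close>; it could leave the unit interval only
    by dropping below \<open>-1\<close>.\<close>
  have "\<beta> * r \<le> 2"
  proof (rule ccontr)
    assume "\<not> \<beta> * r \<le> 2"
    then have x: "\<beta> * r > 2"
      by simp
    have "d * ((\<beta> * r) * (\<beta> * r - 1)) + \<beta> * (\<beta> * r) = \<beta> * (d * \<beta> * r\<^sup>2 + (\<beta> - d) * r)"
      by (simp add: power2_eq_square algebra_simps)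
    then have "d * ((\<beta> * r) * (\<beta> * r - 1)) + \<beta> * (\<beta> * r) = \<beta>\<^sup>2"
      unfolding root by (simp add: power2_eq_square)
    moreover have "(\<beta> * r) * (\<beta> * r - 1) > 2 * 1"
      using x by (intro mult_strict_mono) auto
    then have "d * ((\<beta> * r) * (\<beta> * r - 1)) > d * (2 * 1)"
      using assms(1) by (rule mult_strict_left_mono)
    moreover have "\<beta> * (\<beta> * r) > \<beta> * 2"
      using x assms(2) by (rule mult_strict_left_mono)
    ultimately show False
      using stab by linarith
  qed
  moreover have "\<beta> * r > 0"
    using assms(2) r by simp
  ultimately have "\<bar>1 - \<beta> * r\<bar> \<le> 1"
    by simp
  then show ?thesis
    by (simp add: u flip: norm_of_real[where 'a = complex])
qed

lemma unstable_root_exists: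
  fixes d \<beta> :: real
  assumes "d > 0" and "\<beta> > 2" and unstab: "\<beta>\<^sup>2 > 2 * d + 2 * \<beta>"
  obtains r where "r < 1" and "\<beta> * r > 2" and "d * \<beta> * r\<^sup>2 + (\<beta> - d) * r = \<beta>"
proof -
  define q where "q = (\<lambda>r. d * \<beta> * r\<^sup>2 + (\<beta> - d) * r)"
  \<comment> \<open>The point \<open>2 / \<beta>\<close> is where the amplification factor
    \<open>1 - \<beta> * r\<close> equals \<open>-1\<close>.\<close>
  have "q (2 / \<beta>) = (2 * d + 2 * \<beta>) / \<beta>"
    using assms(2) by (simp add: q_def field_simps power2_eq_square)
  also have "\<dots> < \<beta>"
    using assms by (simp add: divide_less_eq power2_eq_square)
  finally have lo: "q (2 / \<beta>) < \<beta>" .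
  \<comment> \<open>The gap is \<open>d * (\<beta> - 1)\<close>.\<close>
  have hi: "\<beta> < q 1"
    using assms by (simp add: q_def)
  have "continuous_on {2 / \<beta>..1} q"
    unfolding q_def by (intro continuous_intros)
  then obtain r where r: "2 / \<beta> \<le> r" "r \<le> 1" "q r = \<beta>"
    using IVT'[of q "2 / \<beta>" \<beta> 1] lo hi assms(2) by auto
  with lo hi have "2 / \<beta> < r" "r < 1"
    by (auto simp: order.order_iff_strict)
  with r(3) assms(2) show thesis
    by (intro that) (auto simp: q_def field_simps)
qed

lemma le_one_plus_sqrt_iff:
  fixes d \<beta> :: real
  assumes "d \<ge> 0" and "\<beta> \<ge> 0"
  shows "\<beta> \<le> 1 + sqrt (1 + 2 * d) \<longleftrightarrow> \<beta>\<^sup>2 \<le> 2 * d + 2 * \<beta>"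
proof -
  have "sqrt (1 + 2 * d) \<ge> 1"
    using assms by simp
  \<comment> \<open>The other half of the absolute value bound is automatic:
    \<open>1 - \<beta> \<le> 1 \<le> sqrt (1 + 2 * d)\<close>.\<close>
  then have "\<beta> \<le> 1 + sqrt (1 + 2 * d) \<longleftrightarrow> \<bar>\<beta> - 1\<bar> \<le> sqrt (1 + 2 * d)"
    using assms by linarith
  also have "\<dots> \<longleftrightarrow> (\<beta> - 1)\<^sup>2 \<le> 1 + 2 * d"
    by (metis real_sqrt_abs real_sqrt_le_iff)
  also have "\<dots> \<longleftrightarrow> \<beta>\<^sup>2 \<le> 2 * d + 2 * \<beta>"
    by (auto simp: power2_eq_square algebra_simps)
  finally show ?thesis .
qed

theorem theorem1:
  fixes \<nu> \<rho> c b \<Delta>t \<Delta>z d \<beta> :: real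
  assumes "\<nu> > 0" and "\<rho> > 0" and "c > 0" and "b > 0" and "\<Delta>t > 0" and "\<Delta>z > 0"
    and "d = \<nu> * \<Delta>t / (\<rho> * c * \<Delta>z\<^sup>2)"
    and "\<beta> = b * \<Delta>t / (\<rho> * c * \<Delta>z)"
  shows "normal_mode_stable (heat_scheme_solution d \<beta>) \<longleftrightarrow> \<beta> \<le> 1 + sqrt (1 + 2 * d)"
proof -
  have d: "d > 0" and \<beta>: "\<beta> > 0"
    using assms by simp_all
  note threshold = le_one_plus_sqrt_iff[OF less_imp_le[OF d] less_imp_le[OF \<beta>]]
  show ?thesis
  proof
    assume le: "\<beta> \<le> 1 + sqrt (1 + 2 * d)"
    show "normal_mode_stable (heat_scheme_solution d \<beta>)"
      unfolding normal_mode_stable_def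
    proof (intro allI impI, elim conjE)
      fix T A \<kappa>
      assume sol: "heat_scheme_solution d \<beta> T" and form: "has_normal_mode_form T A \<kappa>"
        and far: "cmod \<kappa> > 1"
      define u where "u = 1 - inverse \<kappa>"
      have \<kappa>: "\<kappa> \<noteq> 0"
        using form by (simp add: has_normal_mode_form_def)
      have A: "A = 1 - of_real \<beta> * u"
        and quad: "of_real d * of_real \<beta> * u\<^sup>2 + (of_real \<beta> - of_real d) * u = complex_of_real \<beta>"
        using sol[unfolded normal_mode_solution_iff[OF form]
            dispersion_relation_iff[OF \<kappa> u_def]] by auto
      have "cmod (1 - u) < 1"
        using far by (simp add: u_def norm_inverse inverse_less_1_iff)
      with d \<beta> le quad show "cmod A \<le> 1"
        unfolding A threshold by (intro amplification_bounded)
    qed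
  next
    assume stable: "normal_mode_stable (heat_scheme_solution d \<beta>)"
    show "\<beta> \<le> 1 + sqrt (1 + 2 * d)"
    proof (rule ccontr)
      assume gt: "\<not> \<beta> \<le> 1 + sqrt (1 + 2 * d)"
      then have "\<beta>\<^sup>2 > 2 * d + 2 * \<beta>"
        unfolding threshold by simp
      \<comment> \<open>The threshold thus exceeds \<open>2\<close>, which places
        \<open>2 / \<beta>\<close> to the left of \<open>1\<close>.\<close>
      moreover have "sqrt (1 + 2 * d) > 1"
        using d by simp
      then have "\<beta> > 2"
        using gt by linarith
      ultimately obtain r where r: "r < 1" "\<beta> * r > 2" "d * \<beta> * r\<^sup>2 + (\<beta> - d) * r = \<beta>"
        using unstable_root_exists d by blast
      \<comment> \<open>This inverts \<open>u = 1 - inverse \<kappa>\<close> at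
        \<open>u = r\<close>; \<open>0 < r < 1\<close> then yields the far-field condition.\<close>
      define \<kappa> where "\<kappa> = complex_of_real (1 / (1 - r))"
      define A where "A = complex_of_real (1 - \<beta> * r)"
      define T where "T = (\<lambda>n j. A ^ n * \<kappa> powi j)"
      have "r > 0"
        using r(2) \<beta> by (smt (verit) mult_nonneg_nonpos)
      then have far: "cmod \<kappa> > 1"
        using r(1) unfolding \<kappa>_def norm_of_real by simp
      have \<kappa>: "\<kappa> \<noteq> 0" and u: "complex_of_real r = 1 - inverse \<kappa>"
        using r(1) by (simp_all add: \<kappa>_def)
      have A: "cmod A > 1"
        using r(2) unfolding A_def norm_of_real by simp
      then have form: "has_normal_mode_form T A \<kappa>"
        using \<kappa> by (auto simp: has_normal_mode_form_def T_def)
      have "of_real (d * \<beta> * r\<^sup>2 + (\<beta> - d) * r) = complex_of_real \<beta>"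
        using r(3) by simp
      then have "heat_scheme_solution d \<beta> T"
        unfolding normal_mode_solution_iff[OF form] dispersion_relation_iff[OF \<kappa> u]
        by (simp add: A_def)
      with stable form far A show False
        by (fastforce simp: normal_mode_stable_def)
    qed
  qed
qed

end
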